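(* Let $f:\mathbb{R}\to\mathbb{R}$ be a locally integrable function (a fixed pointwise representative of an element of $L^1_{\mathrm{loc}}(\mathbb{R})$) and let $x_0\in\mathbb{R}$. Assume that the first symmetric Borel derivative $SBD^{1}f(x_0)$ exists finitely and equals $L$, and that $f$ is Borel smooth at $x_0$. Then $T_f'$ has the Łojasiewicz distributional point value $L$ at $x_0$. Equivalently, \[ \lim_{\varepsilon\to 0^+}\langle T_f',\phi_{x_0,\varepsilon}\rangle =L\int_{\mathbb{R}}\phi(u)\,du \qquad \text{for every } \phi\in\mathcal{D}(\mathbb{R}). \]
   Context: $\mathcal{D}(\mathbb{R})=C_c^\infty(\mathbb{R})$ and $\mathcal{D}'(\mathbb{R})$ is the space of distributions. For $f\in L^1_{\mathrm{loc}}(\mathbb{R})$, $T_f\in\mathcal{D}'(\mathbb{R})$ is the regular distribution $\langle T_f,\psi\rangle=\int_{\mathbb{R}} f\psi\,dx$, and its distributional derivative is $\langle T_f',\psi\rangle=-\langle T_f,\psi'\rangle$. For $\phi\in\mathcal{D}(\mathbb{R})$ and $\varepsilon>0$, $\phi_{x_0,\varepsilon}(x)=\varepsilon^{-1}\phi\left(\frac{x-x_0}{\varepsilon}\right)$. The first symmetric Borel derivative of $f$ at $x_0$ is \[ SBD^{1}f(x_0)=\lim_{h\to 0^+}\frac{1}{h}\int_0^h \frac{f(x_0+t)-f(x_0-t)}{2t}\,dt, \] whenever this limit exists finitely. The function $f$ is Borel smooth at $x_0$ if \[ \lim_{h\to 0^+}\frac{1}{h}\int_0^h\frac{f(x_0+t)+f(x_0-t)-2f(x_0)}{t}\,dt=0.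 \] In both cases it is part of the condition that the integrand is Lebesgue integrable on $(0,h)$ for all sufficiently small $h>0$. A distribution $T$ has the Łojasiewicz distributional point value $L\in\mathbb{R}$ at $x_0$ if $\lim_{\varepsilon\to 0^+}\langle T,\phi_{x_0,\varepsilon}\rangle=L\int_{\mathbb{R}}\phi(u)\,du$ for every $\phi\in\mathcal{D}(\mathbb{R})$. *)

theory Defs
  imports "HOL-Analysis.Analysis"
begin

text \<open>
  Everything is taken with respect to \<^const>\<open>lebesgue\<close> (the completion of \<^const>\<open>lborel\<close>), so that
  locally integrable functions are Lebesgue measurable and need not be Borel measurable.
\<close>

definition locally_integrable :: "(real \<Rightarrow> real) \<Rightarrow> bool" where
  "locally_integrable f \<longleftrightarrow> (\<forall>K. compact K \<longrightarrow> set_integrable lebesgue K f)"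

definition smooth :: "(real \<Rightarrow> real) \<Rightarrow> bool" where
  "smooth \<phi> \<longleftrightarrow> (\<forall>n x. (deriv ^^ n) \<phi> field_differentiable at x)"

definition supp :: "(real \<Rightarrow> real) \<Rightarrow> real set" where
  "supp \<phi> = closure {x. \<phi> x \<noteq> 0}"

definition test_functions :: "(real \<Rightarrow> real) set" where
  "test_functions = {\<phi>. smooth \<phi> \<and> compact (supp \<phi>)}"

text \<open>
  A distribution is a linear functional on test functions satisfying the usual seminorm estimates
  on every compact set, which is continuity for the standard topology. Functionals are total here;
  their values outside \<^const>\<open>test_functions\<close> are irrelevant.
\<close>

definition distribution :: "((real \<Rightarrow> real) \<Rightarrow> real) \<Rightarrow> bool" where
  "distribution T \<longleftrightarrow>
     (\<forall>\<phi>\<in>test_functions. \<forall>\<psi>\<in>test_functions. T (\<lambda>x. \<phi> x + \<psi> x) = T \<phi> + T \<psi>) \<and>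
     (\<forall>\<phi>\<in>test_functions. \<forall>c. T (\<lambda>x. c * \<phi> x) = c * T \<phi>) \<and>
     (\<forall>K. compact K \<longrightarrow>
        (\<exists>C N. \<forall>\<phi>\<in>test_functions. supp \<phi> \<subseteq> K \<longrightarrow>
           \<bar>T \<phi>\<bar> \<le> C * (\<Sum>k\<le>N. SUP x. \<bar>(deriv ^^ k) \<phi> x\<bar>)))"

definition regular_distribution :: "(real \<Rightarrow> real) \<Rightarrow> (real \<Rightarrow> real) \<Rightarrow> real" where
  "regular_distribution f \<psi> = (LINT x|lebesgue. f x * \<psi> x)"

definition distribution_deriv :: "((real \<Rightarrow> real) \<Rightarrow> real) \<Rightarrow> (real \<Rightarrow> real) \<Rightarrow> real" where
  "distribution_deriv T \<psi> = - T (deriv \<psi>)"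

definition rescale :: "(real \<Rightarrow> real) \<Rightarrow> real \<Rightarrow> real \<Rightarrow> real \<Rightarrow> real" where
  "rescale \<phi> x\<^sub>0 \<epsilon> x = inverse \<epsilon> * \<phi> ((x - x\<^sub>0) / \<epsilon>)"

definition has_point_value :: "((real \<Rightarrow> real) \<Rightarrow> real) \<Rightarrow> real \<Rightarrow> real \<Rightarrow> bool" where
  "has_point_value T x\<^sub>0 L \<longleftrightarrow> distribution T \<and>
     (\<forall>\<phi>\<in>test_functions.
        ((\<lambda>\<epsilon>. T (rescale \<phi> x\<^sub>0 \<epsilon>)) \<longlongrightarrow> L * (LINT u|lebesgue. \<phi> u)) (at_right 0))"

text \<open>
  Integrability has to be demanded explicitly in the next two definitions, because the Bochner
  integral of a non-integrable function is 0 by convention.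
\<close>

definition has_SBD1 :: "(real \<Rightarrow> real) \<Rightarrow> real \<Rightarrow> real \<Rightarrow> bool" where
  "has_SBD1 f x\<^sub>0 L \<longleftrightarrow>
     (\<forall>\<^sub>F h in at_right 0.
        set_integrable lebesgue {0<..<h} (\<lambda>t. (f (x\<^sub>0 + t) - f (x\<^sub>0 - t)) / (2 * t))) \<and>
     ((\<lambda>h. 1 / h * (LINT t:{0<..<h}|lebesgue. (f (x\<^sub>0 + t) - f (x\<^sub>0 - t)) / (2 * t))) \<longlongrightarrow> L)
       (at_right 0)"

definition borel_smooth :: "(real \<Rightarrow> real) \<Rightarrow> real \<Rightarrow> bool" where
  "borel_smooth f x\<^sub>0 \<longleftrightarrow>
     (\<forall>\<^sub>F h in at_right 0.
        set_integrable lebesgue {0<..<h} (\<lambda>t. (f (x\<^sub>0 + t) + f (x\<^sub>0 - t) - 2 * f x\<^sub>0) / t)) \<and>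
     ((\<lambda>h. 1 / h * (LINT t:{0<..<h}|lebesgue. (f (x\<^sub>0 + t) + f (x\<^sub>0 - t) - 2 * f x\<^sub>0) / t)) \<longlongrightarrow> 0)
       (at_right 0)"

end

theory Submission
  imports Defs
begin

text \<open>
  Put \<open>\<psi> = \<phi>'\<close>. Since \<open>\<psi>\<close> has integral 0, \<open>f\<close> may be replaced by \<open>f - f(x\<^sub>0)\<close> in the pairing with the
  dilates of \<open>\<psi>\<close>; folding the line at \<open>x\<^sub>0\<close> and splitting \<open>\<psi>\<close> into its even and odd parts turns
  the pairing into two integrals \<open>1/\<epsilon> \<integral>\<^sub>0 g(t) k(t/\<epsilon>) dt\<close>, where \<open>g\<close> is one of the two quotients whose
  averages over \<open>(0,h)\<close> converge by hypothesis, and \<open>k\<close> absorbs the missing factor \<open>t/\<epsilon>\<close>.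
  No bound on the averages of \<open>\<bar>g\<bar>\<close> is available, so such integrals are integrated by parts: they only
  see the primitive \<open>\<integral>\<^sub>0\<^sup>s g = l s + o(s)\<close>, and therefore tend to \<open>l \<integral>\<^sub>0 k\<close>. The even part contributes 0
  and the odd part \<open>- L \<integral> u \<psi>(u) du = L \<integral> \<phi>\<close>.
\<close>

section \<open>Lebesgue integration: bounded continuous factors and folding the line\<close>

text \<open>The product is dominated by \<open>M * \<bar>g x\<bar>\<close> on \<open>K\<close>. The
  first part supplies the integrability of all pairings below, the second the seminorm estimate for
  the derivative of the regular distribution.\<close>

lemma set_integrable_mult_continuous:
  fixes g \<psi> :: "real \<Rightarrow> real"
  assumes g: "set_integrable lebesgue K g" and \<psi>: "continuous_on UNIV \<psi>"
    and bnd: "\<And>x. x \<in> K \<Longrightarrow> \<bar>\<psi> x\<bar> \<le> M"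
  shows "set_integrable lebesgue K (\<lambda>x. g x * \<psi> x)"
    and "\<bar>LINT x:K|lebesgue. g x * \<psi> x\<bar> \<le> M * (LINT x:K|lebesgue. \<bar>g x\<bar>)"
proof -
  have gK: "integrable lebesgue (\<lambda>x. indicator K x * g x)"
    using g by (simp add: set_integrable_def)
  have \<psi>m: "\<psi> \<in> borel_measurable lebesgue"
    using borel_measurable_continuous_onI[OF \<psi>] by (intro measurable_completion) simp
  have int: "integrable lebesgue (\<lambda>x. M * \<bar>indicator K x * g x\<bar>)"
    using gK by simp
  have le: "\<bar>indicator K x * g x * \<psi> x\<bar> \<le> M * \<bar>indicator K x * g x\<bar>" for x
    using bnd[of x] by (cases "x \<in> K") (auto simp: abs_mult mult.commute[of M] intro!: mult_left_mono)
  have i: "integrable lebesgue (\<lambda>x. indicator K x * g x * \<psi> x)"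
  proof (rule Bochner_Integration.integrable_bound[OF int])
    show "(\<lambda>x. indicator K x * g x * \<psi> x) \<in> borel_measurable lebesgue"
      by (intro borel_measurable_times[OF borel_measurable_integrable[OF gK] \<psi>m])
    have "\<bar>indicator K x * g x * \<psi> x\<bar> \<le> \<bar>M * \<bar>indicator K x * g x\<bar>\<bar>" for x
      using le[of x] by linarith
    then show "AE x in lebesgue. norm (indicator K x * g x * \<psi> x) \<le> norm (M * \<bar>indicator K x * g x\<bar>)"
      by simp
  qed
  then show "set_integrable lebesgue K (\<lambda>x. g x * \<psi> x)"
    by (simp add: set_integrable_def mult.assoc)
  have "\<bar>LINT x|lebesgue. indicator K x * g x * \<psi> x\<bar> \<le> (LINT x|lebesgue. \<bar>indicator K x * g x * \<psi> x\<bar>)"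
    by (rule integral_abs_bound)
  also have "\<dots> \<le> (LINT x|lebesgue. M * \<bar>indicator K x * g x\<bar>)"
    using i int le by (intro integral_mono) auto
  finally show "\<bar>LINT x:K|lebesgue. g x * \<psi> x\<bar> \<le> M * (LINT x:K|lebesgue. \<bar>g x\<bar>)"
    by (simp add: set_lebesgue_integral_def abs_mult mult.assoc)
qed

lemma integral_split_half_line:
  fixes F :: "real \<Rightarrow> real"
  assumes F: "integrable lebesgue F"
  shows "(LINT t|lebesgue. F t) = (LINT t:{0<..}|lebesgue. F t + F (- t))"
proof -
  have F': "integrable lebesgue (\<lambda>t. F (- t))"
    using lebesgue_integrable_real_affine[OF F, of "-1" 0] by simp
  have i1: "set_integrable lebesgue {0<..} F" "set_integrable lebesgue {0<..} (\<lambda>t. F (- t))"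
    "set_integrable lebesgue {..<0} F"
    using F F' unfolding set_integrable_def by (intro integrable_mult_indicator; simp)+
  have ae: "AE t in lebesgue. t \<noteq> (0::real)"
    using AE_lborel_singleton[of "0::real"] by (rule AE_completion)
  have "(LINT t|lebesgue. F t) = (LINT t|lebesgue. indicator {0<..} t * F t + indicator {..<0} t * F t)"
  proof (rule integral_cong_AE)
    show "(\<lambda>t. indicator {0<..} t * F t + indicator {..<0} t * F t) \<in> borel_measurable lebesgue"
      using i1(1,3) unfolding set_integrable_def real_scaleR_def
      by (intro borel_measurable_add borel_measurable_integrable)
    show "AE t in lebesgue. F t = indicator {0<..} t * F t + indicator {..<0} t * F t"
      using ae by eventually_elim (auto simp: indicator_def)
  qed (rule borel_measurable_integrable[OF F])
  also have "\<dots> = (LINT t:{0<..}|lebesgue. F t) + (LINT t:{..<0}|lebesgue. F t)"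
    using i1 by (simp add: set_integrable_def set_lebesgue_integral_def)
  also have "(LINT t:{..<0}|lebesgue. F t) = (LINT t:{0<..}|lebesgue. F (- t))"
    unfolding set_lebesgue_integral_def
    by (subst lebesgue_integral_real_affine[of "-1" _ 0]) (auto simp: indicator_def intro!: Bochner_Integration.integral_cong)
  finally show ?thesis using i1 by (simp add: set_integral_add)
qed

section \<open>Averages against dilated kernels\<close>

text \<open>
  Integration by parts against the primitive of \<open>g\<close>, which need not be differentiable everywhere:
  write \<open>k(t) = - \<integral>\<^sub>t\<^sup>a k'\<close> and apply Fubini, after passing to a Borel representative of \<open>g\<close>.
\<close>

lemma integral_mult_bound_of_average:
  fixes g k k' :: "real \<Rightarrow> real"
  assumes a: "0 < a" and g: "set_integrable lebesgue {0<..<a} g"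
    and k: "\<And>t. (k has_real_derivative k' t) (at t)" and k': "continuous_on UNIV k'"
    and ka: "k a = 0" and M: "\<And>t. 0 < t \<Longrightarrow> t < a \<Longrightarrow> \<bar>k' t\<bar> \<le> M"
    and G: "\<And>s. 0 < s \<Longrightarrow> s < a \<Longrightarrow> \<bar>LINT t:{0<..<s}|lebesgue. g t\<bar> \<le> \<eta> * s" and \<eta>: "0 \<le> \<eta>"
  shows "\<bar>LINT t:{0<..<a}|lebesgue. g t * k t\<bar> \<le> M * \<eta> * a\<^sup>2"
proof -
  have gi: "integrable lebesgue (\<lambda>t. indicator {0<..<a} t * g t)"
    using g by (simp add: set_integrable_def)
  \<comment> \<open>Fubini is applied on \<open>lborel \<Otimes>\<^sub>M lborel\<close>, so the
    merely Lebesgue measurable integrand is replaced by a Borel function equal to it almost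
    everywhere.\<close>
  obtain g1 where g1m[measurable]: "g1 \<in> borel_measurable lborel"
    and g1: "AE t in lborel. indicator {0<..<a} t * g t = g1 t"
    using completion_ex_borel_measurable_real[OF borel_measurable_integrable[OF gi]] by blast
  note g1c = AE_completion[OF g1]
  have g1i: "integrable lborel g1"
  proof -
    have "integrable lebesgue g1"
      using gi g1c by (subst integrable_cong_AE[symmetric, OF _ _ g1c])
        (auto intro: measurable_completion)
    then show ?thesis by (simp add: integrable_completion)
  qed
  have [measurable]: "k' \<in> borel_measurable borel"
    using k' by (rule borel_measurable_continuous_onI)
  have k'i: "integrable lborel (\<lambda>s. indicator {0..a} s * k' s)"
    using borel_integrable_atLeastAtMost'[of 0 a k'] k'
    by (auto simp: set_integrable_def intro: continuous_on_subset)
  \<comment> \<open>A tensor product of two integrable functions, hence integrable on the plane; it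
    serves only to dominate \<open>H\<close>.\<close>
  define p where "p = (\<lambda>t s. g1 t * (indicator {0..a} s * k' s))"
  have p: "integrable (lborel \<Otimes>\<^sub>M lborel) (case_prod p)"
    unfolding p_def
  proof (rule lborel_pair.Fubini_integrable)
    show "integrable lborel (\<lambda>x. LINT y|lborel. norm (case (x, y) of (t, s) \<Rightarrow> g1 t * (indicator {0..a} s * k' s)))"
      using g1i by (simp add: abs_mult)
  qed (use k'i in simp_all)
  \<comment> \<open>\<open>g1 t * k' s\<close> on the triangle below the diagonal. Integrating first
    in \<open>s\<close> gives \<open>- g1 t * k t\<close> because \<open>k a = 0\<close>;
    integrating first in \<open>t\<close> gives \<open>k' s\<close> times the primitive of
    \<open>g\<close> at \<open>s\<close>, the only quantity that \<open>G\<close> controls.\<close>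
  define H where "H = (\<lambda>t s. if 0 < t \<and> t \<le> s \<and> s < a then g1 t * k' s else 0)"
  have Hi: "integrable (lborel \<Otimes>\<^sub>M lborel) (case_prod H)"
  proof (rule Bochner_Integration.integrable_bound[OF p])
    show "case_prod H \<in> borel_measurable (lborel \<Otimes>\<^sub>M lborel)"
      unfolding H_def by measurable
  qed (auto simp: H_def p_def indicator_def)
  have ae0: "AE t in lborel. t \<noteq> c" for c :: real
    by (rule AE_lborel_singleton)
  have inner_s: "(LINT s|lborel. H t s) = - (indicator {0<..<a} t * g1 t * k t)" for t
  proof (cases "0 < t \<and> t < a")
    case True
    \<comment> \<open>\<open>H\<close> leaves out \<open>s = a\<close>, whereas the fundamental
      theorem of calculus uses the closed interval; the two integrands differ at one point
      only.\<close>
    have "(LINT s|lborel. H t s) = (LINT s|lborel. g1 t * (indicator {t..a} s *\<^sub>R k' s))"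
      using True ae0[of a] unfolding H_def
      by (intro integral_cong_AE) (auto simp: indicator_def)
    also have "\<dots> = g1 t * (k a - k t)"
      using True k k'
      by (subst integral_mult_right_zero, subst integral_FTC_atLeastAtMost[where F = k])
        (auto simp: has_real_derivative_iff_has_vector_derivative[symmetric]
          intro: DERIV_subset continuous_on_subset)
    finally show ?thesis using True ka by simp
  next
    case False
    then have "H t s = 0" for s by (auto simp: H_def)
    then show ?thesis using False by (auto simp: indicator_def)
  qed
  have lhs: "(LINT t|lborel. (LINT s|lborel. H t s)) = - (LINT t:{0<..<a}|lebesgue. g t * k t)"
  proof -
    have [measurable]: "k \<in> borel_measurable borel"
      using k by (intro borel_measurable_continuous_onI) (meson DERIV_isCont continuous_at_imp_continuous_on)
    have "(LINT t:{0<..<a}|lebesgue. g t * k t) = (LINT t|lebesgue. (indicator {0<..<a} t * g t) * k t)"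
      by (simp add: set_lebesgue_integral_def mult.assoc)
    also have "\<dots> = (LINT t|lebesgue. indicator {0<..<a} t * g1 t * k t)"
      using gi g1c
      by (intro integral_cong_AE borel_measurable_times borel_measurable_integrable[OF gi])
        (auto intro!: measurable_completion simp: indicator_def split: if_splits)
    also have "\<dots> = (LINT t|lborel. indicator {0<..<a} t * g1 t * k t)"
      by (rule integral_completion) measurable
    finally show ?thesis by (simp add: inner_s)
  qed
  have inner_t: "(LINT t|lborel. H t s) = indicator {0<..<a} s * (k' s * (LINT t:{0<..<s}|lebesgue. g t))" for s
  proof (cases "0 < s \<and> s < a")
    case True
    have "(LINT t:{0<..<s}|lebesgue. g t) = (LINT t|lebesgue. indicator {0<..<s} t * (indicator {0<..<a} t * g t))"
      using True by (auto simp: set_lebesgue_integral_def indicator_def intro!: Bochner_Integration.integral_cong)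
    \<comment> \<open>Two changes on null sets at once: \<open>g\<close> becomes \<open>g1\<close>,
      and the endpoint \<open>t = s\<close>, which \<open>H\<close> includes, is added.\<close>
    also have "\<dots> = (LINT t|lebesgue. indicator {0<..s} t * g1 t)"
      using g1c AE_completion[OF ae0[of s]]
      by (intro integral_cong_AE borel_measurable_times borel_measurable_integrable[OF gi])
        (auto intro!: measurable_completion simp: indicator_def split: if_splits)
    also have "\<dots> = (LINT t|lborel. indicator {0<..s} t * g1 t)"
      by (rule integral_completion) measurable
    finally have *: "(LINT t:{0<..<s}|lebesgue. g t) = \<dots>" .
    have "(LINT t|lborel. H t s) = (LINT t|lborel. k' s * (indicator {0<..s} t * g1 t))"
      using True by (intro Bochner_Integration.integral_cong) (auto simp: H_def indicator_def)
    then show ?thesis using True * by simp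
  next
    case False
    then have "H t s = 0" for t by (auto simp: H_def)
    then show ?thesis using False by (auto simp: indicator_def)
  qed
  have M0: "0 \<le> M" using M[of "a / 2"] a by auto
  have Gi: "integrable lborel (\<lambda>s. LINT t|lborel. H t s)"
    using lborel_pair.integrable_snd[OF Hi] .
  have ci: "integrable lborel (\<lambda>s. indicator {0<..<a} s *\<^sub>R (M * \<eta> * a))"
    using a by (intro integrable_scaleR_left integrable_real_indicator) auto
  have "\<bar>LINT t:{0<..<a}|lebesgue. g t * k t\<bar> = \<bar>LINT s|lborel. LINT t|lborel. H t s\<bar>"
    using lborel_pair.Fubini_integral[OF Hi] lhs by simp
  also have "\<dots> \<le> (LINT s|lborel. \<bar>LINT t|lborel. H t s\<bar>)"
    by (rule integral_abs_bound)
  \<comment> \<open>The factors are at most \<open>M\<close> and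
    \<open>\<eta> * s \<le> \<eta> * a\<close>; the length of the interval gives the second factor
    \<open>a\<close>.\<close>
  also have "\<dots> \<le> (LINT s|lborel. indicator {0<..<a} s *\<^sub>R (M * \<eta> * a))"
  proof (rule integral_mono)
    fix s
    show "\<bar>LINT t|lborel. H t s\<bar> \<le> indicator {0<..<a} s *\<^sub>R (M * \<eta> * a)"
    proof (cases "0 < s \<and> s < a")
      case True
      have "\<bar>k' s\<bar> * \<bar>LINT t:{0<..<s}|lebesgue. g t\<bar> \<le> M * (\<eta> * s)"
        using True M[of s] G[of s] M0 by (intro mult_mono) auto
      also have "\<dots> \<le> M * (\<eta> * a)"
        using True M0 \<eta> by (intro mult_left_mono) auto
      finally show ?thesis using True by (simp add: inner_t abs_mult mult.assoc)
    qed (auto simp: inner_t indicator_def)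
  qed (use Gi ci in auto)
  also have "\<dots> = M * \<eta> * a\<^sup>2"
    using a by (simp add: power2_eq_square)
  finally show ?thesis .
qed

text \<open>Halving the threshold makes the upper end inclusive, so that the property may be used at
  \<open>d\<close> itself.\<close>

lemma eventually_at_right_0_realE:
  fixes P :: "real \<Rightarrow> bool"
  assumes "eventually P (at_right 0)"
  obtains d where "0 < d" "\<And>h. 0 < h \<Longrightarrow> h \<le> d \<Longrightarrow> P h"
proof -
  obtain b where "0 < b" "\<And>h. 0 < h \<Longrightarrow> h < b \<Longrightarrow> P h"
    using assms by (auto simp: eventually_at_right_field)
  then show ?thesis by (intro that[of "b / 2"]) auto
qed

text \<open>The kernel sees only \<open>{0<..<\<epsilon> * R}\<close>, which shrinks to 0. The
  constant \<open>l\<close> contributes exactly \<open>l\<close> times the integral of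
  \<open>k\<close>, by the substitution t = \<epsilon> u. The remainder \<open>g t - l\<close> has
  averages below \<eta> near 0, so the previous lemma bounds its contribution uniformly in
  \<epsilon>.\<close>

lemma
  fixes g k k' :: "real \<Rightarrow> real"
  assumes R: "0 < R"
    and g: "\<forall>\<^sub>F h in at_right 0. set_integrable lebesgue {0<..<h} g"
    and avg: "((\<lambda>h. 1 / h * (LINT t:{0<..<h}|lebesgue. g t)) \<longlongrightarrow> l) (at_right 0)"
    and k: "\<And>t. (k has_real_derivative k' t) (at t)" and k': "continuous_on UNIV k'"
    and kR: "\<And>u. R \<le> u \<Longrightarrow> k u = 0"
  shows eventually_set_integrable_mult_dilation:
      "\<forall>\<^sub>F \<epsilon> in at_right 0. set_integrable lebesgue {0<..} (\<lambda>t. g t * k (t / \<epsilon>))"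
    and tendsto_average_dilation:
      "((\<lambda>\<epsilon>. 1 / \<epsilon> * (LINT t:{0<..}|lebesgue. g t * k (t / \<epsilon>)))
         \<longlongrightarrow> l * (LINT u:{0<..}|lebesgue. k u)) (at_right 0)"
proof -
  obtain h0 where h0: "0 < h0" "set_integrable lebesgue {0<..<h0} g"
    using g by (elim eventually_at_right_0_realE) (meson order_refl)
  \<comment> \<open>\<open>kR\<close> makes the half-line and the bounded interval interchangeable
    under the integral; the factor \<open>c\<close> stands for whatever multiplies the
    kernel.\<close>
  have ind: "indicator {0<..} t * (c * k (t / \<epsilon>)) = indicator {0<..<\<epsilon> * R} t * (c * k (t / \<epsilon>))"
    if "0 < \<epsilon>" for c t \<epsilon>
    using kR[of "t / \<epsilon>"] that by (auto simp: indicator_def field_simps)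
  have kc: "continuous_on UNIV k"
    using k by (meson DERIV_isCont continuous_at_imp_continuous_on)
  have kce: "continuous_on UNIV (\<lambda>t. k (t / \<epsilon>))" if "0 < \<epsilon>" for \<epsilon>
    using that by (intro continuous_on_compose2[OF kc] continuous_intros) auto
  have bdd: "\<exists>M. \<forall>u\<in>{0..R}. \<bar>q u\<bar> \<le> M" if "continuous_on UNIV q" for q :: "real \<Rightarrow> real"
    using compact_imp_bounded[OF compact_continuous_image[OF continuous_on_subset[OF that] compact_Icc[of 0 R]]]
    by (auto simp: bounded_iff)
  obtain M0 where M0: "\<And>u. 0 < u \<Longrightarrow> u < R \<Longrightarrow> \<bar>k u\<bar> \<le> M0"
    using bdd[OF kc] by (meson atLeastAtMost_iff less_imp_le)
  obtain M where M: "\<And>u. 0 < u \<Longrightarrow> u < R \<Longrightarrow> \<bar>k' u\<bar> \<le> M"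
    using bdd[OF k'] by (meson atLeastAtMost_iff less_imp_le)
  have Mnn: "0 \<le> M" using M[of "R / 2"] R by auto
  \<comment> \<open>Stated for arbitrary \<open>q\<close> because it is applied to \<open>g\<close>,
    to \<open>g - l\<close> and to the constant \<open>l\<close>.\<close>
  have int: "set_integrable lebesgue {0<..<\<epsilon> * R} (\<lambda>t. q t * k (t / \<epsilon>))"
    if "0 < \<epsilon>" "set_integrable lebesgue {0<..<\<epsilon> * R} q" for q \<epsilon>
    using that M0 by (intro set_integrable_mult_continuous(1)[OF _ kce, of _ _ _ M0]) (auto simp: field_simps)
  have gint: "set_integrable lebesgue {0<..<h} g" if "h \<le> h0" for h
    using h0(2) by (rule set_integrable_subset) (use that in auto)
  have small: "\<forall>\<^sub>F \<epsilon> in at_right 0. 0 < \<epsilon> \<and> \<epsilon> * R < d" if "0 < d" for d :: real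
    unfolding eventually_at_right_field using that R
    by (intro exI[of _ "d / R"]) (auto simp: field_simps)
  have one: "set_integrable lebesgue {0<..<h} (\<lambda>t. l)" for h :: real
    using lmeasurable_box[of 0 h] unfolding set_integrable_def box_real
    by (intro integrable_scaleR_left integrable_real_indicator) (auto simp: fmeasurable_def)
  show "\<forall>\<^sub>F \<epsilon> in at_right 0. set_integrable lebesgue {0<..} (\<lambda>t. g t * k (t / \<epsilon>))"
    using small[OF h0(1)]
  proof eventually_elim
    case (elim \<epsilon>)
    then show ?case
      using int[of \<epsilon> g] gint[of "\<epsilon> * R"] by (simp add: set_integrable_def ind)
  qed
  show "((\<lambda>\<epsilon>. 1 / \<epsilon> * (LINT t:{0<..}|lebesgue. g t * k (t / \<epsilon>)))
         \<longlongrightarrow> l * (LINT u:{0<..}|lebesgue. k u)) (at_right 0)"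
  proof (rule tendstoI)
    fix e :: real assume e: "0 < e"
    \<comment> \<open>Chosen so that \<open>M * \<eta> * R\<^sup>2 < e\<close>; the summand 1 keeps
      the denominator positive when \<open>M = 0\<close>.\<close>
    define \<eta> where "\<eta> = e / (M * R\<^sup>2 + 1)"
    have den: "0 < M * R\<^sup>2 + 1" using Mnn by (simp add: add_nonneg_pos)
    have \<eta>: "0 < \<eta>" using e den by (simp add: \<eta>_def)
    have bound: "M * \<eta> * R\<^sup>2 < e"
    proof -
      have "M * \<eta> * R\<^sup>2 < \<eta> * (M * R\<^sup>2 + 1)" using \<eta> by (simp add: algebra_simps)
      also have "\<dots> = e" using den by (simp add: \<eta>_def)
      finally show ?thesis .
    qed
    obtain \<delta> where \<delta>: "0 < \<delta>"
      "\<And>h. 0 < h \<Longrightarrow> h \<le> \<delta> \<Longrightarrow> \<bar>1 / h * (LINT t:{0<..<h}|lebesgue. g t) - l\<bar> < \<eta>"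
      using tendstoD[OF avg \<eta>] by (elim eventually_at_right_0_realE) (auto simp: dist_real_def)
    show "\<forall>\<^sub>F \<epsilon> in at_right 0. dist (1 / \<epsilon> * (LINT t:{0<..}|lebesgue. g t * k (t / \<epsilon>)))
         (l * (LINT u:{0<..}|lebesgue. k u)) < e"
      using small[OF h0(1)] small[OF \<delta>(1)]
    proof eventually_elim
      case (elim \<epsilon>)
      then have \<epsilon>: "0 < \<epsilon>" "\<epsilon> * R < h0" "\<epsilon> * R < \<delta>" by auto
      let ?I = "{0<..<\<epsilon> * R}"
      have gl: "set_integrable lebesgue ?I (\<lambda>t. g t - l)"
        using gint[of "\<epsilon> * R"] one \<epsilon> by (intro set_integral_diff) auto
      have "(LINT t:{0<..}|lebesgue. g t * k (t / \<epsilon>)) = (LINT t:?I|lebesgue. g t * k (t / \<epsilon>))"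
        using \<epsilon> by (simp add: set_lebesgue_integral_def ind)
      also have "\<dots> = (LINT t:?I|lebesgue. (g t - l) * k (t / \<epsilon>) + l * k (t / \<epsilon>))"
        by (simp add: algebra_simps)
      also have "\<dots> = (LINT t:?I|lebesgue. (g t - l) * k (t / \<epsilon>)) + (LINT t:?I|lebesgue. l * k (t / \<epsilon>))"
        using int[OF \<epsilon>(1) gl] int[OF \<epsilon>(1) one] by (rule set_integral_add)
      also have "(LINT t:?I|lebesgue. l * k (t / \<epsilon>)) = l * (LINT t|lebesgue. indicator {0<..} t * k (t / \<epsilon>))"
        unfolding set_lebesgue_integral_def real_scaleR_def ind[OF \<epsilon>(1), symmetric]
        by (simp add: mult.left_commute)
      also have "(LINT t|lebesgue. indicator {0<..} t * k (t / \<epsilon>)) = \<epsilon> * (LINT u:{0<..}|lebesgue. k u)"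
        unfolding set_lebesgue_integral_def
        using \<epsilon> by (subst lebesgue_integral_real_affine[of \<epsilon> _ 0])
          (auto simp: indicator_def zero_less_mult_iff intro!: Bochner_Integration.integral_cong)
      finally have "1 / \<epsilon> * (LINT t:{0<..}|lebesgue. g t * k (t / \<epsilon>)) - l * (LINT u:{0<..}|lebesgue. k u)
          = 1 / \<epsilon> * (LINT t:?I|lebesgue. (g t - l) * k (t / \<epsilon>))"
        using \<epsilon> by (simp add: field_simps)
      \<comment> \<open>The dilated kernel has derivative at most \<open>M / \<epsilon>\<close> on
        an interval of length \<open>\<epsilon> * R\<close>. After division by \<epsilon>, all
        powers of \<epsilon> cancel and \<open>M * \<eta> * R\<^sup>2\<close> remains.\<close>
      moreover have "\<bar>LINT t:?I|lebesgue. (g t - l) * k (t / \<epsilon>)\<bar> \<le> M / \<epsilon> * \<eta> * (\<epsilon> * R)\<^sup>2"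
      proof (rule integral_mult_bound_of_average[where k' = "\<lambda>t. k' (t / \<epsilon>) / \<epsilon>"])
        show "0 < \<epsilon> * R" "set_integrable lebesgue ?I (\<lambda>t. g t - l)" "0 \<le> \<eta>"
          using \<epsilon> R gl \<eta> by auto
        show "((\<lambda>t. k (t / \<epsilon>)) has_real_derivative k' (t / \<epsilon>) / \<epsilon>) (at t)" for t
          using DERIV_chain2[OF k DERIV_cdivide[OF DERIV_ident], of \<epsilon> t] by simp
        show "continuous_on UNIV (\<lambda>t. k' (t / \<epsilon>) / \<epsilon>)"
          using \<epsilon> by (intro continuous_intros continuous_on_compose2[OF k']) auto
        show "k (\<epsilon> * R / \<epsilon>) = 0" using kR[of R] \<epsilon> by simp
        show "\<bar>k' (t / \<epsilon>) / \<epsilon>\<bar> \<le> M / \<epsilon>" if "0 < t" "t < \<epsilon> * R" for t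
          using M[of "t / \<epsilon>"] that \<epsilon> by (simp add: field_simps)
        show "\<bar>LINT t:{0<..<s}|lebesgue. g t - l\<bar> \<le> \<eta> * s" if "0 < s" "s < \<epsilon> * R" for s
        proof -
          have "(LINT t:{0<..<s}|lebesgue. g t - l) = (LINT t:{0<..<s}|lebesgue. g t) - l * s"
            using that \<epsilon> gint[of s] one[of s]
            by (subst set_integral_diff) (auto simp: set_lebesgue_integral_def)
          also have "\<dots> = s * (1 / s * (LINT t:{0<..<s}|lebesgue. g t) - l)"
            using that by (simp add: field_simps)
          also have "\<bar>\<dots>\<bar> \<le> s * \<eta>"
            using that \<epsilon> \<delta>(2)[of s] by (simp add: abs_mult del: times_divide_eq_left)
          finally show ?thesis by (simp add: mult.commute)
        qed
      qed
      then have "1 / \<epsilon> * \<bar>LINT t:?I|lebesgue. (g t - l) * k (t / \<epsilon>)\<bar> \<le> 1 / \<epsilon> * (M / \<epsilon> * \<eta> * (\<epsilon> * R)\<^sup>2)"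
        using \<epsilon> by (intro mult_left_mono) auto
      then have "\<bar>1 / \<epsilon> * (LINT t:?I|lebesgue. (g t - l) * k (t / \<epsilon>))\<bar> \<le> M * \<eta> * R\<^sup>2"
        using \<epsilon> by (simp add: abs_mult power2_eq_square field_simps)
      ultimately show ?case
        using bound by (simp add: dist_real_def)
    qed
  qed
qed

section \<open>Derivatives of test functions\<close>

lemma DERIV_deriv_funpow_smooth:
  "smooth \<phi> \<Longrightarrow> ((deriv ^^ n) \<phi> has_real_derivative (deriv ^^ Suc n) \<phi> x) (at x)"
  by (simp add: smooth_def DERIV_deriv_iff_field_differentiable)

lemma continuous_deriv_funpow_smooth:
  "smooth \<phi> \<Longrightarrow> continuous_on UNIV ((deriv ^^ n) \<phi>)"
  using DERIV_deriv_funpow_smooth[of \<phi> n] by (meson DERIV_isCont continuous_at_imp_continuous_on)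

text \<open>The complement of the support is open, so a derivative that vanishes there vanishes near
  each of its points, and its own derivative is 0 there too.\<close>

lemma deriv_funpow_eq_0_outside_supp:
  assumes "x \<notin> supp \<phi>"
  shows "(deriv ^^ n) \<phi> x = 0"
  using assms
proof (induction n arbitrary: x)
  case 0
  then show ?case using closure_subset by (force simp: supp_def)
next
  case (Suc n)
  have "open (- supp \<phi>)" by (simp add: supp_def open_Compl)
  then have "((deriv ^^ n) \<phi> has_real_derivative 0) (at x)"
    by (rule has_field_derivative_transform_within_open[OF DERIV_const]) (use Suc in auto)
  then show ?case by (simp add: DERIV_imp_deriv)
qed

lemma test_function_bounded_support:
  assumes "\<phi> \<in> test_functions"
  obtains R where "0 < R" "\<And>n u. R \<le> \<bar>u\<bar> \<Longrightarrow> (deriv ^^ n) \<phi> u = 0"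
proof -
  have "bounded (supp \<phi>)" using assms by (simp add: test_functions_def compact_imp_bounded)
  then obtain b where b: "0 < b" "\<And>x. x \<in> supp \<phi> \<Longrightarrow> \<bar>x\<bar> \<le> b"
    by (auto simp: bounded_pos)
  \<comment> \<open>The support may reach \<bar>x\<bar> = b, hence the larger radius
    \<open>b + 1\<close>. It does not depend on the order of the derivative.\<close>
  have "u \<notin> supp \<phi>" if "b + 1 \<le> \<bar>u\<bar>" for u using b(2)[of u] that by auto
  with b show ?thesis by (intro that[of "b + 1"] deriv_funpow_eq_0_outside_supp) auto
qed

text \<open>A real \<open>SUP\<close> is an upper bound only if the range is bounded above, so this
  comes before any use of the seminorms in \<open>distribution\<close>.\<close>

lemma bdd_above_deriv_funpow_test_function:
  assumes "\<phi> \<in> test_functions"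
  shows "bdd_above (range (\<lambda>x. \<bar>(deriv ^^ n) \<phi> x\<bar>))"
proof -
  have "compact ((\<lambda>x. \<bar>(deriv ^^ n) \<phi> x\<bar>) ` supp \<phi>)"
    using assms by (intro compact_continuous_image continuous_intros
        continuous_on_subset[OF continuous_deriv_funpow_smooth]) (auto simp: test_functions_def)
  then obtain M where M: "\<And>x. x \<in> supp \<phi> \<Longrightarrow> \<bar>(deriv ^^ n) \<phi> x\<bar> \<le> M"
    by (force dest!: compact_imp_bounded simp: bounded_iff)
  have "\<bar>(deriv ^^ n) \<phi> x\<bar> \<le> max M 0" for x
    using M[of x] deriv_funpow_eq_0_outside_supp[of x \<phi> n] by (cases "x \<in> supp \<phi>") auto
  then show ?thesis by (intro bdd_aboveI[of _ "max M 0"]) auto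
qed

section \<open>The derivative of a regular distribution is a distribution\<close>

lemma integrable_mult_deriv_test_function:
  assumes f: "locally_integrable f" and \<phi>: "\<phi> \<in> test_functions"
    and K: "compact K" "supp \<phi> \<subseteq> K"
  shows "integrable lebesgue (\<lambda>x. f x * (deriv ^^ n) \<phi> x)"
    and "\<bar>LINT x|lebesgue. f x * (deriv ^^ n) \<phi> x\<bar> \<le>
      (SUP x. \<bar>(deriv ^^ n) \<phi> x\<bar>) * (LINT x:K|lebesgue. \<bar>f x\<bar>)"
proof -
  have ind: "indicator K x * (f x * (deriv ^^ n) \<phi> x) = f x * (deriv ^^ n) \<phi> x" for x
    using K deriv_funpow_eq_0_outside_supp[of x \<phi> n] by (auto simp: indicator_def)
  have fK: "set_integrable lebesgue K f" using f K by (simp add: locally_integrable_def)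
  have c: "continuous_on UNIV ((deriv ^^ n) \<phi>)"
    using \<phi> by (simp add: test_functions_def continuous_deriv_funpow_smooth)
  have b: "\<bar>(deriv ^^ n) \<phi> x\<bar> \<le> (SUP x. \<bar>(deriv ^^ n) \<phi> x\<bar>)" for x
    by (rule cSUP_upper[OF UNIV_I bdd_above_deriv_funpow_test_function[OF \<phi>]])
  show "integrable lebesgue (\<lambda>x. f x * (deriv ^^ n) \<phi> x)"
    using set_integrable_mult_continuous(1)[OF fK c b] by (simp add: set_integrable_def ind)
  show "\<bar>LINT x|lebesgue. f x * (deriv ^^ n) \<phi> x\<bar> \<le>
      (SUP x. \<bar>(deriv ^^ n) \<phi> x\<bar>) * (LINT x:K|lebesgue. \<bar>f x\<bar>)"
    using set_integrable_mult_continuous(2)[OF fK c b] by (simp add: set_lebesgue_integral_def ind)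
qed

text \<open>Required by \<open>has_point_value\<close>. The estimate has order 1: the supremum of
  \<open>\<bar>deriv \<phi> x\<bar>\<close> times the integral of \<open>\<bar>f\<bar>\<close> over
  \<open>K\<close>.\<close>

lemma distribution_distribution_deriv_regular:
  assumes f: "locally_integrable f"
  shows "distribution (distribution_deriv (regular_distribution f))"
  unfolding distribution_def
proof (intro conjI ballI allI impI)
  fix \<phi> \<psi> :: "real \<Rightarrow> real" assume t: "\<phi> \<in> test_functions" "\<psi> \<in> test_functions"
  then have d: "\<phi> field_differentiable at x" "\<psi> field_differentiable at x" for x
    unfolding test_functions_def smooth_def by (auto dest: spec[of _ 0])
  have "integrable lebesgue (\<lambda>x. f x * deriv \<phi> x)" "integrable lebesgue (\<lambda>x. f x * deriv \<psi> x)"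
    using integrable_mult_deriv_test_function(1)[OF f t(1), of "supp \<phi>" 1]
      integrable_mult_deriv_test_function(1)[OF f t(2), of "supp \<psi>" 1] t
    by (simp_all add: test_functions_def)
  then show "distribution_deriv (regular_distribution f) (\<lambda>x. \<phi> x + \<psi> x) =
      distribution_deriv (regular_distribution f) \<phi> + distribution_deriv (regular_distribution f) \<psi>"
    by (simp add: distribution_deriv_def regular_distribution_def deriv_add[OF d] distrib_left)
next
  fix \<phi> :: "real \<Rightarrow> real" and c :: real assume "\<phi> \<in> test_functions"
  then have d: "\<phi> field_differentiable at x" for x
    unfolding test_functions_def smooth_def by (auto dest: spec[of _ 0])
  show "distribution_deriv (regular_distribution f) (\<lambda>x. c * \<phi> x) =
      c * distribution_deriv (regular_distribution f) \<phi>"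
    by (simp add: distribution_deriv_def regular_distribution_def deriv_cmult[OF d] mult.left_commute)
next
  fix K :: "real set" assume K: "compact K"
  let ?C = "LINT x:K|lebesgue. \<bar>f x\<bar>"
  have C: "0 \<le> ?C" by (simp add: set_lebesgue_integral_def)
  have "\<bar>distribution_deriv (regular_distribution f) \<phi>\<bar> \<le> ?C * (\<Sum>k\<le>1. SUP x. \<bar>(deriv ^^ k) \<phi> x\<bar>)"
    if \<phi>: "\<phi> \<in> test_functions" "supp \<phi> \<subseteq> K" for \<phi>
  proof -
    \<comment> \<open>The seminorm sum also contains the term \<open>k = 0\<close>; being
      nonnegative, it only enlarges the bound.\<close>
    have "0 \<le> (SUP x. \<bar>\<phi> x\<bar>)"
      using bdd_above_deriv_funpow_test_function[OF \<phi>(1), of 0] by (intro cSUP_upper2) auto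
    then have "(SUP x. \<bar>deriv \<phi> x\<bar>) * ?C \<le> ?C * (\<Sum>k\<le>1. SUP x. \<bar>(deriv ^^ k) \<phi> x\<bar>)"
      using C by (simp add: mult.commute[of _ ?C] mult_left_mono)
    then show ?thesis
      using integrable_mult_deriv_test_function(2)[OF f \<phi>(1) K \<phi>(2), of 1]
      by (simp add: distribution_deriv_def regular_distribution_def)
  qed
  then show "\<exists>C N. \<forall>\<phi>\<in>test_functions. supp \<phi> \<subseteq> K \<longrightarrow>
      \<bar>distribution_deriv (regular_distribution f) \<phi>\<bar> \<le> C * (\<Sum>k\<le>N. SUP x. \<bar>(deriv ^^ k) \<phi> x\<bar>)"
    by blast
qed

section \<open>The point value at \<open>x\<^sub>0\<close>\<close>

text \<open>The fundamental theorem on [-R, R], where both boundary values vanish. Used for \<phi>,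
  giving that \<psi> has integral 0, and for u \<phi>(u), giving the first moment of \<psi>.\<close>

lemma integral_deriv_compact_support:
  fixes F F' :: "real \<Rightarrow> real"
  assumes F: "\<And>x. (F has_real_derivative F' x) (at x)" and F': "continuous_on UNIV F'"
    and F0: "\<And>x. R \<le> \<bar>x\<bar> \<Longrightarrow> F x = 0" "\<And>x. R \<le> \<bar>x\<bar> \<Longrightarrow> F' x = 0" and R: "0 < R"
  shows "integrable lebesgue F'" and "(LINT x|lebesgue. F' x) = 0"
proof -
  have ind: "indicator {- R..R} x *\<^sub>R F' x = F' x" for x
    using F0(2)[of x] by (cases "R \<le> \<bar>x\<bar>") (auto simp: indicator_def)
  have F'c: "continuous_on {- R..R} F'" using F' by (rule continuous_on_subset) simp
  have i: "integrable lborel F'"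
    using borel_integrable_atLeastAtMost'[OF F'c] by (simp add: set_integrable_def ind del: real_scaleR_def)
  then have m: "F' \<in> borel_measurable lborel" by simp
  show "integrable lebesgue F'" using i m by (simp add: integrable_completion)
  have "(LINT x|lborel. F' x) = F R - F (- R)"
  proof -
    have "(F has_vector_derivative F' x) (at x within S)" for x S
      using F[THEN DERIV_subset[OF _ subset_UNIV]] by (simp add: has_real_derivative_iff_has_vector_derivative)
    from integral_FTC_atLeastAtMost[OF _ this F'c] R show ?thesis
      unfolding ind by simp
  qed
  then show "(LINT x|lebesgue. F' x) = 0"
    using m F0(1) R by (simp add: integral_completion)
qed

theorem theorem3p8:
  fixes f :: "real \<Rightarrow> real" and x\<^sub>0 L :: real
  assumes "locally_integrable f"
    and "has_SBD1 f x\<^sub>0 L"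
    and "borel_smooth f x\<^sub>0"
  shows "has_point_value (distribution_deriv (regular_distribution f)) x\<^sub>0 L \<and>
    (\<forall>\<phi>\<in>test_functions.
       ((\<lambda>\<epsilon>. distribution_deriv (regular_distribution f) (rescale \<phi> x\<^sub>0 \<epsilon>))
          \<longlongrightarrow> L * (LINT u|lebesgue. \<phi> u)) (at_right 0))"
proof -
  have "((\<lambda>\<epsilon>. distribution_deriv (regular_distribution f) (rescale \<phi> x\<^sub>0 \<epsilon>))
          \<longlongrightarrow> L * (LINT u|lebesgue. \<phi> u)) (at_right 0)" if \<phi>: "\<phi> \<in> test_functions" for \<phi>
  proof -
    have sm: "smooth \<phi>" using \<phi> by (simp add: test_functions_def)
    obtain R where R: "0 < R" "\<And>n u. R \<le> \<bar>u\<bar> \<Longrightarrow> (deriv ^^ n) \<phi> u = 0"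
      using test_function_bounded_support[OF \<phi>] by blast
    define \<psi> \<psi>' where "\<psi> = deriv \<phi>" and "\<psi>' = deriv \<psi>"
    have D\<phi>: "(\<phi> has_real_derivative \<psi> u) (at u)" for u
      using DERIV_deriv_funpow_smooth[OF sm, of 0] by (simp add: \<psi>_def)
    have D\<psi>: "(\<psi> has_real_derivative \<psi>' u) (at u)" for u
      using DERIV_deriv_funpow_smooth[OF sm, of 1] by (simp add: \<psi>_def \<psi>'_def)
    have cont: "continuous_on UNIV \<phi>" "continuous_on UNIV \<psi>" "continuous_on UNIV \<psi>'"
      using continuous_deriv_funpow_smooth[OF sm, of 0] continuous_deriv_funpow_smooth[OF sm, of 1]
        continuous_deriv_funpow_smooth[OF sm, of 2] by (simp_all add: \<psi>_def \<psi>'_def numeral_2_eq_2)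
    have zero: "\<phi> u = 0" "\<psi> u = 0" "\<psi>' u = 0" if "R \<le> \<bar>u\<bar>" for u
      using R(2)[OF that, of 0] R(2)[OF that, of 1] R(2)[OF that, of 2]
      by (simp_all add: \<psi>_def \<psi>'_def numeral_2_eq_2)
    note cref = continuous_on_compose2[OF cont(1)] continuous_on_compose2[OF cont(2)]
      continuous_on_compose2[OF cont(3)]

    \<comment> \<open>The splitting rests on pq + rs = (p + r)(q + s)/2 + (p - r)(q - s)/2, with p,
      r the increments of \<open>f\<close> at \<open>x\<^sub>0\<close> to the right and to the left,
      and q, s the values of \<psi> at u and -u, where u = t/\<epsilon>. Dividing the first factors
      by t or 2t yields \<open>A\<close> and \<open>B\<close>; multiplying the second ones by u
      compensates, up to a factor \<epsilon>.\<close>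
    define A where "A = (\<lambda>t. (f (x\<^sub>0 + t) + f (x\<^sub>0 - t) - 2 * f x\<^sub>0) / t)"
    define B where "B = (\<lambda>t. (f (x\<^sub>0 + t) - f (x\<^sub>0 - t)) / (2 * t))"
    define k where "k = (\<lambda>u. u * ((\<psi> u + \<psi> (- u)) / 2))"
    define m where "m = (\<lambda>u. u * (\<psi> u - \<psi> (- u)))"
    define k' where "k' = (\<lambda>u. (\<psi> u + \<psi> (- u)) / 2 + u * ((\<psi>' u - \<psi>' (- u)) / 2))"
    define m' where "m' = (\<lambda>u. (\<psi> u - \<psi> (- u)) + u * (\<psi>' u + \<psi>' (- u)))"
    have D\<psi>m: "((\<lambda>u. \<psi> (- u)) has_real_derivative - \<psi>' (- u)) (at u)" for u
      using DERIV_chain2[OF D\<psi> DERIV_minus[OF DERIV_ident]] by simp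
    have kD: "(k has_real_derivative k' u) (at u)" for u
      unfolding k_def k'_def by (auto intro!: derivative_eq_intros D\<psi> D\<psi>m simp: field_simps)
    have mD: "(m has_real_derivative m' u) (at u)" for u
      unfolding m_def m'_def by (auto intro!: derivative_eq_intros D\<psi> D\<psi>m simp: field_simps)
    have k'c: "continuous_on UNIV k'" and m'c: "continuous_on UNIV m'"
      unfolding k'_def m'_def by (auto intro!: continuous_intros cref cont)
    have kR: "k u = 0" and mR: "m u = 0" if "R \<le> u" for u
      using that zero[of u] zero[of "- u"] by (auto simp: k_def m_def)
    have Ai: "\<forall>\<^sub>F h in at_right 0. set_integrable lebesgue {0<..<h} A"
      and Al: "((\<lambda>h. 1 / h * (LINT t:{0<..<h}|lebesgue. A t)) \<longlongrightarrow> 0) (at_right 0)"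
      using assms(3) by (simp_all add: borel_smooth_def A_def)
    have Bi: "\<forall>\<^sub>F h in at_right 0. set_integrable lebesgue {0<..<h} B"
      and Bl: "((\<lambda>h. 1 / h * (LINT t:{0<..<h}|lebesgue. B t)) \<longlongrightarrow> L) (at_right 0)"
      using assms(2) by (simp_all add: has_SBD1_def B_def)
    have Aint: "\<forall>\<^sub>F \<epsilon> in at_right 0. set_integrable lebesgue {0<..} (\<lambda>t. A t * k (t / \<epsilon>))"
      by (rule eventually_set_integrable_mult_dilation[OF R(1) Ai Al kD k'c kR])
    have Alim: "((\<lambda>\<epsilon>. 1 / \<epsilon> * (LINT t:{0<..}|lebesgue. A t * k (t / \<epsilon>)))
        \<longlongrightarrow> 0 * (LINT u:{0<..}|lebesgue. k u)) (at_right 0)"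
      by (rule tendsto_average_dilation[OF R(1) Ai Al kD k'c kR])
    have Bint: "\<forall>\<^sub>F \<epsilon> in at_right 0. set_integrable lebesgue {0<..} (\<lambda>t. B t * m (t / \<epsilon>))"
      by (rule eventually_set_integrable_mult_dilation[OF R(1) Bi Bl mD m'c mR])
    have Blim: "((\<lambda>\<epsilon>. 1 / \<epsilon> * (LINT t:{0<..}|lebesgue. B t * m (t / \<epsilon>)))
        \<longlongrightarrow> L * (LINT u:{0<..}|lebesgue. m u)) (at_right 0)"
      by (rule tendsto_average_dilation[OF R(1) Bi Bl mD m'c mR])

    have \<psi>int: "integrable lebesgue \<psi>" "(LINT u|lebesgue. \<psi> u) = 0"
      using integral_deriv_compact_support[OF D\<phi> cont(2) zero(1,2) R(1)] by auto
    \<comment> \<open>\<open>m\<close> is u \<psi>(u) folded at 0, so its half-line integral is the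
      first moment of \<psi>, which equals minus the integral of \<phi> because (u \<phi>(u))' =
      \<phi>(u) + u \<psi>(u) has integral 0.\<close>
    have half: "(LINT u:{0<..}|lebesgue. m u) = - (LINT u|lebesgue. \<phi> u)"
    proof -
      have "((\<lambda>u. u * \<phi> u) has_real_derivative \<phi> u + u * \<psi> u) (at u)" for u
        by (auto intro!: derivative_eq_intros D\<phi>)
      moreover have "continuous_on UNIV (\<lambda>u. \<phi> u + u * \<psi> u)"
        by (intro continuous_intros cont)
      ultimately have i: "integrable lebesgue (\<lambda>u. \<phi> u + u * \<psi> u)" "(LINT u|lebesgue. \<phi> u + u * \<psi> u) = 0"
        using integral_deriv_compact_support[where F = "\<lambda>u. u * \<phi> u" and R = R] R(1) zero by simp_all
      \<comment> \<open>The pairing lemma with the constant function 1 in place of \<open>f\<close>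
        and no derivative.\<close>
      have i\<phi>: "integrable lebesgue \<phi>"
      proof -
        have "set_integrable lebesgue K (\<lambda>_. 1 :: real)" if "compact K" for K :: "real set"
        proof -
          have "K \<in> sets lebesgue" "emeasure lebesgue K < \<infinity>"
            using lmeasurable_compact[OF that] by (auto simp only: fmeasurable_def mem_Collect_eq infinity_ennreal_def)
          then have "integrable lebesgue (indicator K :: real \<Rightarrow> real)"
            by (rule integrable_real_indicator)
          then show ?thesis by (simp add: set_integrable_def)
        qed
        then have "locally_integrable (\<lambda>_. 1)"
          by (simp add: locally_integrable_def)
        then show ?thesis
          using integrable_mult_deriv_test_function(1)[of "\<lambda>_. 1" \<phi> "supp \<phi>" 0] \<phi>
          by (simp add: test_functions_def)
      qed
      have i\<psi>: "integrable lebesgue (\<lambda>u. u * \<psi> u)"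
        using Bochner_Integration.integrable_diff[OF i(1) i\<phi>] by simp
      have "(LINT u:{0<..}|lebesgue. m u) = (LINT u|lebesgue. u * \<psi> u)"
        by (simp add: integral_split_half_line[OF i\<psi>] m_def algebra_simps)
      then show ?thesis using i i\<phi> i\<psi> by simp
    qed

    \<comment> \<open>The decomposition is an exact identity for small \<epsilon>, not merely one in
      the limit. \<open>Aint\<close> and \<open>Bint\<close> allow the integral of the sum to be
      split.\<close>
    have "\<forall>\<^sub>F \<epsilon> in at_right 0. - (1 / \<epsilon> * (LINT t:{0<..}|lebesgue. A t * k (t / \<epsilon>))
        + 1 / \<epsilon> * (LINT t:{0<..}|lebesgue. B t * m (t / \<epsilon>)))
        = distribution_deriv (regular_distribution f) (rescale \<phi> x\<^sub>0 \<epsilon>)"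
      using Aint Bint eventually_at_right_less[of 0]
    proof eventually_elim
      case (elim \<epsilon>)
      then have \<epsilon>: "0 < \<epsilon>" by simp
      have D: "deriv (rescale \<phi> x\<^sub>0 \<epsilon>) x = inverse (\<epsilon>\<^sup>2) * \<psi> ((x - x\<^sub>0) / \<epsilon>)" for x
      proof (rule DERIV_imp_deriv)
        have "((\<lambda>x. \<phi> ((x - x\<^sub>0) / \<epsilon>)) has_real_derivative \<psi> ((x - x\<^sub>0) / \<epsilon>) * (1 / \<epsilon>)) (at x)"
          using \<epsilon> by (intro DERIV_chain2[OF D\<phi>]) (auto intro!: derivative_eq_intros)
        from DERIV_cmult[OF this, of "inverse \<epsilon>"]
        show "(rescale \<phi> x\<^sub>0 \<epsilon> has_real_derivative inverse (\<epsilon>\<^sup>2) * \<psi> ((x - x\<^sub>0) / \<epsilon>)) (at x)"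
          using \<epsilon> by (simp add: rescale_def[abs_def] power2_eq_square field_simps)
      qed
      let ?K = "{x\<^sub>0 - \<epsilon> * R..x\<^sub>0 + \<epsilon> * R}"
      have \<psi>\<epsilon>0: "\<psi> ((x - x\<^sub>0) / \<epsilon>) = 0" if "x \<notin> ?K" for x
        using that \<epsilon> by (intro zero(2)) (auto simp: abs_if field_simps)
      have c\<psi>: "continuous_on UNIV (\<lambda>x. \<psi> ((x - x\<^sub>0) / \<epsilon>))"
        using \<epsilon> by (intro cref continuous_intros) auto
      have "\<bar>\<psi> u\<bar> \<le> (SUP x. \<bar>\<psi> x\<bar>)" for u
        using bdd_above_deriv_funpow_test_function[OF \<phi>, of 1]
        by (intro cSUP_upper) (auto simp: \<psi>_def)
      then have "set_integrable lebesgue ?K (\<lambda>x. f x * \<psi> ((x - x\<^sub>0) / \<epsilon>))"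
        using assms(1) c\<psi> by (intro set_integrable_mult_continuous(1)) (auto simp: locally_integrable_def)
      moreover have "indicator ?K x * (f x * \<psi> ((x - x\<^sub>0) / \<epsilon>)) = f x * \<psi> ((x - x\<^sub>0) / \<epsilon>)" for x
        using \<psi>\<epsilon>0[of x] by (auto simp: indicator_def)
      ultimately have i: "integrable lebesgue (\<lambda>x. f x * \<psi> ((x - x\<^sub>0) / \<epsilon>))"
        by (simp add: set_integrable_def)
      have j: "integrable lebesgue (\<lambda>t. f (x\<^sub>0 + t) * \<psi> (t / \<epsilon>))"
        using lebesgue_integrable_real_affine[OF i, of 1 x\<^sub>0] by simp
      have \<psi>\<epsilon>: "integrable lebesgue (\<lambda>t. \<psi> (t / \<epsilon>))" "(LINT t|lebesgue. \<psi> (t / \<epsilon>)) = 0"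
        using \<epsilon> lebesgue_integrable_real_affine[OF \<psi>int(1), of "1 / \<epsilon>" 0]
          lebesgue_integral_real_affine[of "1 / \<epsilon>" \<psi> 0] \<psi>int(2) by auto
      have ij: "integrable lebesgue (\<lambda>t. (f (x\<^sub>0 + t) - f x\<^sub>0) * \<psi> (t / \<epsilon>))"
        using j \<psi>\<epsilon>(1) by (simp add: left_diff_distrib)
      \<comment> \<open>Positivity of t permits cancelling the denominators of \<open>A\<close> and
        \<open>B\<close>; this is why the line is folded before the splitting.\<close>
      have alg: "(f (x\<^sub>0 + t) - f x\<^sub>0) * \<psi> (t / \<epsilon>) + (f (x\<^sub>0 - t) - f x\<^sub>0) * \<psi> (- (t / \<epsilon>))
          = \<epsilon> * (A t * k (t / \<epsilon>)) + \<epsilon> * (B t * m (t / \<epsilon>))" if "0 < t" for t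
        using that \<epsilon> by (simp add: A_def B_def k_def m_def field_simps)
      have "(LINT x|lebesgue. f x * \<psi> ((x - x\<^sub>0) / \<epsilon>)) = (LINT t|lebesgue. f (x\<^sub>0 + t) * \<psi> (t / \<epsilon>))"
        by (subst lebesgue_integral_real_affine[of 1 _ x\<^sub>0]) auto
      also have "\<dots> = (LINT t|lebesgue. (f (x\<^sub>0 + t) - f x\<^sub>0) * \<psi> (t / \<epsilon>))"
        using j \<psi>\<epsilon> by (simp add: left_diff_distrib)
      also have "\<dots> = (LINT t:{0<..}|lebesgue.
          (f (x\<^sub>0 + t) - f x\<^sub>0) * \<psi> (t / \<epsilon>) + (f (x\<^sub>0 - t) - f x\<^sub>0) * \<psi> (- (t / \<epsilon>)))"
        by (subst integral_split_half_line[OF ij]) simp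
      also have "\<dots> = (LINT t:{0<..}|lebesgue. \<epsilon> * (A t * k (t / \<epsilon>)) + \<epsilon> * (B t * m (t / \<epsilon>)))"
        unfolding set_lebesgue_integral_def
        using alg by (intro Bochner_Integration.integral_cong refl) (simp add: indicator_def)
      also have "\<dots> = \<epsilon> * (LINT t:{0<..}|lebesgue. A t * k (t / \<epsilon>))
          + \<epsilon> * (LINT t:{0<..}|lebesgue. B t * m (t / \<epsilon>))"
        using elim by (subst set_integral_add) auto
      finally have E: "(LINT x|lebesgue. f x * \<psi> ((x - x\<^sub>0) / \<epsilon>)) =
          \<epsilon> * (LINT t:{0<..}|lebesgue. A t * k (t / \<epsilon>))
          + \<epsilon> * (LINT t:{0<..}|lebesgue. B t * m (t / \<epsilon>))" .
      have "distribution_deriv (regular_distribution f) (rescale \<phi> x\<^sub>0 \<epsilon>) =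
          - (inverse (\<epsilon>\<^sup>2) * (LINT x|lebesgue. f x * \<psi> ((x - x\<^sub>0) / \<epsilon>)))"
        by (simp add: distribution_deriv_def regular_distribution_def D mult.left_commute[of _ "inverse (\<epsilon>\<^sup>2)"])
      moreover have "inverse (\<epsilon>\<^sup>2) * (\<epsilon> * p + \<epsilon> * q) = 1 / \<epsilon> * p + 1 / \<epsilon> * q" for p q
        using \<epsilon> by (simp add: power2_eq_square field_simps)
      ultimately show ?case by (simp only: E)
    qed
    moreover have "((\<lambda>\<epsilon>. - (1 / \<epsilon> * (LINT t:{0<..}|lebesgue. A t * k (t / \<epsilon>))
        + 1 / \<epsilon> * (LINT t:{0<..}|lebesgue. B t * m (t / \<epsilon>)))) \<longlongrightarrow> L * (LINT u|lebesgue. \<phi> u)) (at_right 0)"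
      \<comment> \<open>The sign from the distributional derivative and the sign in
        \<open>half\<close> cancel.\<close>
      using tendsto_minus[OF tendsto_add[OF Alim Blim]] by (simp add: half)
    ultimately show ?thesis by (rule Lim_transform_eventually[rotated])
  qed
  then show ?thesis
    using distribution_distribution_deriv_regular[OF assms(1)] by (simp add: has_point_value_def)
qed

end
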